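(* Let $P(x,y)\in\mathbb{R}[x,y]$ be a given polynomial in two variables. For each oscillating tableau $T=(\lambda^0,\ldots,\lambda^l)$, let $\mathrm{wt}_P(T):=\sum_{i=0}^{l}P(|\lambda^i|,i)$. Then there exists a polynomial $Q(x,y)\in\mathbb{R}[x,y]$ with the same (total) degree and the same constant term as $P(x,y)$ such that $$\frac{1}{\#\mathcal{OT}(\lambda,|\lambda|+2n)}\sum_{T\in\mathcal{OT}(\lambda,|\lambda|+2n)}\mathrm{wt}_P(T)=(|\lambda|+2n+1)\,Q(|\lambda|,|\lambda|+2n)$$ for every $n\in\mathbb{N}$ and every partition $\lambda$.
   Context: $\mathbb{N}=\{0,1,2,\ldots\}$. A partition is a finite weakly decreasing sequence of positive integers (the empty sequence $\emptyset$ is allowed); its size $|\lambda|$ is the sum of its parts, and it is identified with its Young diagram. An oscillating tableau of shape $\lambda$ and length $l$ is a sequence of partitions $T=(\lambda^0,\lambda^1,\ldots,\lambda^l)$ with $\lambda^0=\emptyset$, $\lambda^l=\lambda$, and, for each $0\le i\le l-1$, $\lambda^{i+1}$ obtained from $\lambda^i$ by adding one box to or removing one box from its Young diagram. $\mathcal{OT}(\lambda,l)$ denotes the set of oscillating tableaux of shape $\lambda$ and length $l$. *)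

theory Defs
  imports Complex_Main "HOL-Computational_Algebra.Polynomial"
begin

definition is_partition :: "nat list \<Rightarrow> bool" where
  "is_partition lam \<longleftrightarrow> sorted_wrt (\<ge>) lam \<and> (\<forall>p\<in>set lam. p > 0)"

abbreviation psize :: "nat list \<Rightarrow> nat" where
  "psize lam \<equiv> sum_list lam"

text \<open>Boxes are pairs (row, column), both counted from 0.\<close>

definition young_diagram :: "nat list \<Rightarrow> (nat \<times> nat) set" where
  "young_diagram lam = {(i, j). i < length lam \<and> j < lam ! i}"

definition adds_box :: "nat list \<Rightarrow> nat list \<Rightarrow> bool" where
  "adds_box lam mu \<longleftrightarrow>
     (\<exists>b. b \<notin> young_diagram lam \<and> young_diagram mu = insert b (young_diagram lam))"

definition oscillating_tableaux :: "nat list \<Rightarrow> nat \<Rightarrow> nat list list set" where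
  "oscillating_tableaux lam l =
     {T. length T = l + 1 \<and> (\<forall>mu\<in>set T. is_partition mu) \<and> T ! 0 = [] \<and> T ! l = lam \<and>
         (\<forall>i<l. adds_box (T ! i) (T ! (i + 1)) \<or> adds_box (T ! (i + 1)) (T ! i))}"

text \<open>
  The ring of polynomials in x and y is represented as the ring of polynomials in y
  whose coefficients are polynomials in x; so the coefficient of the monomial
  x to the i times y to the j in P is \<open>coeff (coeff P j) i\<close>.
\<close>

definition eval2 :: "real poly poly \<Rightarrow> real \<Rightarrow> real \<Rightarrow> real" where
  "eval2 P x y = poly (poly P [:y:]) x"

text \<open>As for \<open>degree\<close>, the zero polynomial has degree 0.\<close>

definition total_degree :: "real poly poly \<Rightarrow> nat" where
  "total_degree P = Max (insert 0 {i + j | i j. coeff (coeff P j) i \<noteq> 0})"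

definition constant_term :: "real poly poly \<Rightarrow> real" where
  "constant_term P = coeff (coeff P 0) 0"

definition wt :: "real poly poly \<Rightarrow> nat list list \<Rightarrow> real" where
  "wt P T = (\<Sum>i<length T. eval2 P (real (psize (T ! i))) (real i))"

end

theory Submission
  imports Defs
begin

text \<open>
  Let \<open>f\<close> count the standard Young tableaux of a shape \<open>lam\<close> of size \<open>k\<close>. Young's lattice is a
  differential poset: \<open>f\<close> summed over the shapes covered by \<open>lam\<close> gives \<open>f lam\<close>, and summed over the
  shapes covering \<open>lam\<close> gives \<open>(k + 1) f lam\<close>. Induction on the length, removing the last step,
  therefore shows that there are \<open>f lam * c k l\<close> tableaux of length \<open>l\<close>, with
  \<open>c k (k + 2 n) = (k + 2 n)! / (k! 2^n n!)\<close>, and that the average weight is \<open>(l + 1) Q(k, l)\<close> as soon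
  as
  \<open>(y + 1) Q(x, y) - (y - x) Q(x + 1, y - 1) - x Q(x - 1, y - 1) = P(x, y)\<close>.
  In the coordinates \<open>x\<close> and \<open>n = (y - x) / 2\<close>, the operator on the left maps the product \<open>e a b\<close> of the
  falling factorials of \<open>x\<close> of order \<open>a\<close> and of \<open>n\<close> of order \<open>b\<close> to
  \<open>(1 + a + 2 b) e a b - 2 a e (a - 1) (b + 1)\<close>.
  So on the polynomials of degree at most \<open>d\<close>, for each \<open>d\<close>, it is triangular with positive diagonal,
  hence bijective, and it preserves the value at the origin.
\<close>

section \<open>Partitions and their covers\<close>

text \<open>Padding with zeros makes opening a new row the same kind of update as lengthening an old
  one, so that no case distinction on the length of the list arises.\<close>

definition row :: "nat list \<Rightarrow> nat \<Rightarrow> nat" where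
  "row lam i = (if i < length lam then lam ! i else 0)"

text \<open>By monotonicity a single zero forces all later values to vanish, so these are exactly
  the functions \<open>row lam\<close> for partitions \<open>lam\<close>.\<close>

definition row_fun :: "(nat \<Rightarrow> nat) \<Rightarrow> bool" where
  "row_fun r \<longleftrightarrow> (\<forall>i. r (Suc i) \<le> r i) \<and> (\<exists>n. r n = 0)"

definition unrow :: "(nat \<Rightarrow> nat) \<Rightarrow> nat list" where
  "unrow r = map r [0..<LEAST n. r n = 0]"

definition inc :: "(nat \<Rightarrow> nat) \<Rightarrow> nat \<Rightarrow> nat \<Rightarrow> nat" where
  "inc r i = r(i := Suc (r i))"

definition dec :: "(nat \<Rightarrow> nat) \<Rightarrow> nat \<Rightarrow> nat \<Rightarrow> nat" where
  "dec r i = r(i := r i - 1)"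

definition addable :: "(nat \<Rightarrow> nat) \<Rightarrow> nat set" where
  "addable r = {i. row_fun (inc r i)}"

text \<open>The condition \<open>0 < r i\<close> excludes the truncated case, in which
  \<open>dec r i = r\<close>.\<close>

definition removable :: "(nat \<Rightarrow> nat) \<Rightarrow> nat set" where
  "removable r = {i. 0 < r i \<and> row_fun (dec r i)}"

definition up :: "nat list \<Rightarrow> nat list set" where
  "up lam = {mu. is_partition mu \<and> adds_box lam mu}"

definition down :: "nat list \<Rightarrow> nat list set" where
  "down lam = {mu. is_partition mu \<and> adds_box mu lam}"

lemma row_fun_antimono: "row_fun r \<Longrightarrow> i \<le> j \<Longrightarrow> r j \<le> r i"
  unfolding row_fun_def by (metis lift_Suc_antimono_le)

lemma row_fun_row:
  assumes "is_partition lam"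
  shows "row_fun (row lam)"
proof -
  have "lam ! Suc i \<le> lam ! i" if "Suc i < length lam" for i
    using assms that unfolding is_partition_def by (auto simp: sorted_wrt_iff_nth_less)
  then have "\<forall>i. row lam (Suc i) \<le> row lam i"
    by (auto simp: row_def)
  moreover have "row lam (length lam) = 0" by (simp add: row_def)
  ultimately show ?thesis unfolding row_fun_def by blast
qed

lemma unrow_row:
  assumes "is_partition lam"
  shows "unrow (row lam) = lam"
proof -
  have "(LEAST n. row lam n = 0) = length lam"
  proof (rule Least_equality)
    fix n assume "row lam n = 0"
    moreover have "0 < row lam n" if "n < length lam"
      using assms that by (auto simp: row_def is_partition_def)
    ultimately show "length lam \<le> n" by linarith
  qed (simp add: row_def)
  moreover have "map (row lam) [0..<length lam] = map ((!) lam) [0..<length lam]"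
    by (simp add: row_def)
  ultimately show ?thesis
    unfolding unrow_def by (simp only: map_nth)
qed

lemma Least_zero:
  assumes "row_fun r"
  shows "r i = 0 \<longleftrightarrow> (LEAST n. r n = 0) \<le> i"
proof
  assume "(LEAST n. r n = 0) \<le> i"
  moreover have "r (LEAST n. r n = 0) = 0"
    using assms unfolding row_fun_def by (metis (mono_tags, lifting) LeastI_ex)
  ultimately show "r i = 0"
    using row_fun_antimono[OF assms] by (metis le_zero_eq)
qed (rule Least_le)

lemma row_unrow:
  assumes "row_fun r"
  shows "row (unrow r) = r"
proof
  fix i show "row (unrow r) i = r i"
    using Least_zero[OF assms, of i] by (auto simp: row_def unrow_def)
qed

lemma is_partition_unrow:
  assumes "row_fun r"
  shows "is_partition (unrow r)"
  unfolding is_partition_def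
proof
  show "sorted_wrt (\<ge>) (unrow r)"
    unfolding unrow_def using row_fun_antimono[OF assms] by (auto simp: sorted_wrt_iff_nth_less)
  show "\<forall>p\<in>set (unrow r). p > 0"
  proof
    fix p assume "p \<in> set (unrow r)"
    then obtain i where "p = r i" "i < (LEAST n. r n = 0)" by (auto simp: unrow_def)
    then show "p > 0" by (metis Least_zero[OF assms] not_gr_zero not_le)
  qed
qed

section \<open>Covers in Young's lattice as unit changes of one row\<close>

lemma young_diagram_row: "young_diagram lam = {(i, j). j < row lam i}"
  by (auto simp: young_diagram_def row_def split: if_splits)

text \<open>Each row of a diagram is an initial segment of the naturals, so a single new box must
  sit at the end of its row.\<close>

lemma adds_box_iff: "adds_box lam mu \<longleftrightarrow> (\<exists>i. row mu = inc (row lam) i)"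
proof
  assume "adds_box lam mu"
  then obtain a b where ab: "(a, b) \<notin> young_diagram lam"
    "young_diagram mu = insert (a, b) (young_diagram lam)"
    unfolding adds_box_def by auto
  have mem: "j < row mu i \<longleftrightarrow> j < row lam i \<or> (i = a \<and> j = b)" for i j
    using ab(2) by (auto simp: young_diagram_row set_eq_iff)
  have "row mu i = row lam i" if "i \<noteq> a" for i
    using mem[of _ i] that by (meson linorder_neqE_nat less_irrefl)
  moreover have "row mu a = Suc (row lam a)"
  proof -
    have "{..<row mu a} = insert b {..<row lam a}" using mem[of _ a] by auto
    moreover have "b \<notin> {..<row lam a}" using ab(1) by (simp add: young_diagram_row)
    ultimately show ?thesis by (metis card_insert_disjoint card_lessThan finite_lessThan)
  qed
  ultimately show "\<exists>i. row mu = inc (row lam) i"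
    by (auto simp: inc_def fun_eq_iff)
next
  assume "\<exists>i. row mu = inc (row lam) i"
  then obtain i where "row mu = inc (row lam) i" by blast
  then show "adds_box lam mu"
    unfolding adds_box_def by (intro exI[of _ "(i, row lam i)"]) (auto simp: young_diagram_row inc_def split: if_splits)
qed

lemma dec_inc: "dec (inc r i) i = r"
  by (simp add: dec_def inc_def)

lemma inc_dec: "0 < r i \<Longrightarrow> inc (dec r i) i = r"
  by (simp add: dec_def inc_def)

lemma inj_inc: "inc r i = inc r j \<Longrightarrow> i = j"
  unfolding inc_def by (metis fun_upd_apply n_not_Suc_n)

lemma bij_betw_up:
  assumes "is_partition lam"
  shows "bij_betw (\<lambda>i. unrow (inc (row lam) i)) (addable (row lam)) (up lam)"
proof (rule bij_betw_imageI)
  show "inj_on (\<lambda>i. unrow (inc (row lam) i)) (addable (row lam))"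
    by (rule inj_onI) (metis addable_def inj_inc mem_Collect_eq row_unrow)
  show "(\<lambda>i. unrow (inc (row lam) i)) ` addable (row lam) = up lam"
  proof (intro equalityI subsetI)
    fix mu assume "mu \<in> up lam"
    then obtain i where "is_partition mu" "row mu = inc (row lam) i"
      by (auto simp: up_def adds_box_iff)
    then have "mu = unrow (inc (row lam) i)" "i \<in> addable (row lam)"
      using unrow_row[of mu] row_fun_row[of mu] by (auto simp: addable_def)
    then show "mu \<in> (\<lambda>i. unrow (inc (row lam) i)) ` addable (row lam)" by blast
  qed (auto simp: addable_def up_def adds_box_iff row_unrow is_partition_unrow)
qed

lemma inj_dec: "0 < r i \<Longrightarrow> 0 < r j \<Longrightarrow> dec r i = dec r j \<Longrightarrow> i = j"
  by (drule fun_cong[of _ _ i]) (auto simp: dec_def split: if_splits)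

lemma bij_betw_down:
  assumes "is_partition lam"
  shows "bij_betw (\<lambda>i. unrow (dec (row lam) i)) (removable (row lam)) (down lam)"
proof (rule bij_betw_imageI)
  show "inj_on (\<lambda>i. unrow (dec (row lam) i)) (removable (row lam))"
    by (rule inj_onI, rule inj_dec[of "row lam"]) (auto simp: removable_def dest: arg_cong[of _ _ row] simp: row_unrow)
  show "(\<lambda>i. unrow (dec (row lam) i)) ` removable (row lam) = down lam"
  proof (intro equalityI subsetI)
    fix mu assume "mu \<in> down lam"
    then obtain i where i: "is_partition mu" "row lam = inc (row mu) i"
      by (auto simp: down_def adds_box_iff)
    then have "dec (row lam) i = row mu" "0 < row lam i"
      by (auto simp: dec_inc) (simp add: inc_def)
    with i have "mu = unrow (dec (row lam) i)" "i \<in> removable (row lam)"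
      using unrow_row[of mu] row_fun_row[of mu] by (auto simp: removable_def)
    then show "mu \<in> (\<lambda>i. unrow (dec (row lam) i)) ` removable (row lam)" by blast
  next
    fix mu assume "mu \<in> (\<lambda>i. unrow (dec (row lam) i)) ` removable (row lam)"
    then obtain i where "mu = unrow (dec (row lam) i)" "0 < row lam i" "row_fun (dec (row lam) i)"
      by (auto simp: removable_def)
    then show "mu \<in> down lam"
      by (auto simp: down_def adds_box_iff row_unrow is_partition_unrow intro!: exI[of _ i] inc_dec[symmetric])
  qed
qed

section \<open>Corners, and the commutation of adding and removing boxes\<close>

lemma removable_eq:
  assumes "row_fun r"
  shows "removable r = {i. r (Suc i) < r i}"
proof -
  obtain n where n: "r n = 0" and m: "\<And>i. r (Suc i) \<le> r i" using assms unfolding row_fun_def by blast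
  have "row_fun (dec r i)" if "r (Suc i) < r i" for i
    unfolding row_fun_def
  proof
    show "\<forall>j. dec r i (Suc j) \<le> dec r i j"
    proof
      fix j show "dec r i (Suc j) \<le> dec r i j" using m[of j] that by (auto simp: dec_def)
    qed
    show "\<exists>n. dec r i n = 0" using n by (intro exI[of _ n]) (auto simp: dec_def)
  qed
  moreover have "r (Suc i) < r i" if "0 < r i" "row_fun (dec r i)" for i
  proof -
    have "dec r i (Suc i) \<le> dec r i i" using that by (simp add: row_fun_def)
    then show ?thesis using that by (simp add: dec_def)
  qed
  ultimately show ?thesis by (auto simp: removable_def)
qed

text \<open>A box fits into a row other than the first exactly when the row above ends in a corner.
  The extra first row makes the addable rows one more than the removable ones, which is the source
  of the differential relation.\<close>

lemma addable_eq:
  assumes "row_fun r"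
  shows "addable r = insert 0 (Suc ` removable r)"
proof -
  obtain n where n: "r n = 0" and m: "\<And>i. r (Suc i) \<le> r i" using assms unfolding row_fun_def by blast
  have "row_fun (inc r i)" if "i = 0 \<or> r i < r (i - 1)" for i
    unfolding row_fun_def
  proof
    show "\<forall>j. inc r i (Suc j) \<le> inc r i j"
    proof
      fix j show "inc r i (Suc j) \<le> inc r i j" using m[of j] that by (auto simp: inc_def)
    qed
    \<comment> \<open>This index lies past both the known zero \<open>n\<close> and the altered row
      \<open>i\<close>.\<close>
    have "r (Suc (n + i)) = 0" using n row_fun_antimono[OF assms, of n "Suc (n + i)"] by simp
    then show "\<exists>n. inc r i n = 0" by (intro exI[of _ "Suc (n + i)"]) (auto simp: inc_def)
  qed
  moreover have "r (Suc i) < r i" if "row_fun (inc r (Suc i))" for i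
  proof -
    have "inc r (Suc i) (Suc i) \<le> inc r (Suc i) i" using that unfolding row_fun_def by blast
    then show ?thesis by (simp add: inc_def)
  qed
  ultimately have "i \<in> addable r \<longleftrightarrow> i \<in> insert 0 (Suc ` removable r)" for i
    by (cases i) (auto simp: removable_eq[OF assms] addable_def)
  then show ?thesis by blast
qed

lemma finite_removable:
  assumes "row_fun r"
  shows "finite (removable r)"
proof -
  obtain n where n: "r n = 0" using assms unfolding row_fun_def by blast
  have "i < n" if "i \<in> removable r" for i
    using row_fun_antimono[OF assms, of n i] n that by (cases "n \<le> i") (auto simp: removable_def)
  then have "removable r \<subseteq> {..<n}" by blast
  then show ?thesis by (rule finite_subset) simp
qed

lemma finite_addable: "row_fun r \<Longrightarrow> finite (addable r)"
  by (simp add: addable_eq finite_removable)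

lemma card_addable: "row_fun r \<Longrightarrow> card (addable r) = Suc (card (removable r))"
  by (subst addable_eq) (auto simp: finite_removable card_image)

lemma dec_inc_commute: "i \<noteq> j \<Longrightarrow> dec (inc r i) j = inc (dec r j) i"
  by (auto simp: dec_def inc_def)

text \<open>Both orders lead to the same function, so only the intermediate shapes need care.
  Lengthening row \<open>i\<close> cannot create a corner in another row \<open>j\<close>, and
  shortening row \<open>j\<close> cannot make room for a box in another row
  \<open>i\<close>.\<close>

lemma addable_removable_swap:
  assumes r: "row_fun r" and "i \<noteq> j"
  shows "i \<in> addable r \<and> j \<in> removable (inc r i) \<longleftrightarrow> j \<in> removable r \<and> i \<in> addable (dec r j)"
proof
  assume a: "i \<in> addable r \<and> j \<in> removable (inc r i)"
  then have "inc r i (Suc j) < inc r i j" using removable_eq[of "inc r i"] by (auto simp: addable_def)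
  then have "j \<in> removable r"
    using \<open>i \<noteq> j\<close> by (auto simp: removable_eq[OF r] inc_def split: if_splits)
  then show "j \<in> removable r \<and> i \<in> addable (dec r j)"
    using a \<open>i \<noteq> j\<close> by (auto simp: removable_def[of "inc r i"] addable_def dec_inc_commute)
next
  assume a: "j \<in> removable r \<and> i \<in> addable (dec r j)"
  then have "i = 0 \<or> (\<exists>k. i = Suc k \<and> dec r j (Suc k) < dec r j k)"
    using addable_eq[of "dec r j"] removable_eq[of "dec r j"] by (auto simp: removable_def[of r])
  then have "i \<in> addable r"
    using \<open>i \<noteq> j\<close> by (auto simp: addable_eq[OF r] removable_eq[OF r] dec_def split: if_splits)
  then show "i \<in> addable r \<and> j \<in> removable (inc r i)"
    using a \<open>i \<noteq> j\<close> by (auto simp: removable_def addable_def dec_inc_commute) (simp add: inc_def)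
qed

text \<open>The terms with \<open>i \<noteq> j\<close> on the two sides match by
  \<open>addable_removable_swap\<close>. Each diagonal term equals \<open>h r\<close>; the left side
  has one for every addable row and the right side one for every removable row, so the surplus is a
  single \<open>h r\<close>.\<close>

lemma sum_inc_dec:
  fixes h :: "(nat \<Rightarrow> nat) \<Rightarrow> real"
  assumes r: "row_fun r"
  shows "(\<Sum>i\<in>addable r. \<Sum>j\<in>removable (inc r i). h (dec (inc r i) j)) =
         (\<Sum>j\<in>removable r. \<Sum>i\<in>addable (dec r j). h (inc (dec r j) i)) + h r"
proof -
  note fin = finite_addable[OF r] finite_removable[OF r]
  have fin_inc: "finite (removable (inc r i))" if "i \<in> addable r" for i
    using that by (simp add: addable_def finite_removable)
  have fin_dec: "finite (addable (dec r j))" if "j \<in> removable r" for j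
    using that by (simp add: removable_def finite_addable)
  have A: "(\<Sum>j\<in>removable (inc r i). h (dec (inc r i) j)) =
      h r + (\<Sum>j\<in>removable (inc r i) - {i}. h (dec (inc r i) j))" if "i \<in> addable r" for i
  proof -
    have "i \<in> removable (inc r i)"
      using r by (simp add: removable_def dec_inc) (simp add: inc_def)
    then show ?thesis using fin_inc[OF that] by (simp add: sum.remove dec_inc)
  qed
  have B: "(\<Sum>i\<in>addable (dec r j). h (inc (dec r j) i)) =
      h r + (\<Sum>i\<in>addable (dec r j) - {j}. h (inc (dec r j) i))" if "j \<in> removable r" for j
  proof -
    have p: "0 < r j" using that by (simp add: removable_def)
    have "j \<in> addable (dec r j)"
      using r p by (simp add: addable_def inc_dec)
    then show ?thesis using fin_dec[OF that] p by (simp add: sum.remove inc_dec)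
  qed
  have "(\<Sum>i\<in>addable r. \<Sum>j\<in>removable (inc r i) - {i}. h (dec (inc r i) j)) =
        (\<Sum>(i, j)\<in>Sigma (addable r) (\<lambda>i. removable (inc r i) - {i}). h (dec (inc r i) j))"
    using fin fin_inc fin_dec by (subst sum.Sigma) auto
  also have "\<dots> = (\<Sum>(j, i)\<in>Sigma (removable r) (\<lambda>j. addable (dec r j) - {j}). h (inc (dec r j) i))"
    by (rule sum.reindex_bij_witness[of _ prod.swap prod.swap])
      (auto, (metis addable_removable_swap[OF r] dec_inc_commute)+)
  also have "\<dots> = (\<Sum>j\<in>removable r. \<Sum>i\<in>addable (dec r j) - {j}. h (inc (dec r j) i))"
    using fin fin_inc fin_dec by (subst sum.Sigma) auto
  finally show ?thesis
    by (simp add: A B sum.distrib card_addable[OF r] algebra_simps)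
qed

lemma sum_up:
  assumes "is_partition lam"
  shows "(\<Sum>mu\<in>up lam. g mu) = (\<Sum>i\<in>addable (row lam). g (unrow (inc (row lam) i)))"
  using sum.reindex_bij_betw[OF bij_betw_up[OF assms], of g] by simp

lemma sum_down:
  assumes "is_partition lam"
  shows "(\<Sum>mu\<in>down lam. g mu) = (\<Sum>i\<in>removable (row lam). g (unrow (dec (row lam) i)))"
  using sum.reindex_bij_betw[OF bij_betw_down[OF assms], of g] by simp

lemma finite_up: "is_partition lam \<Longrightarrow> finite (up lam)"
  using bij_betw_finite[OF bij_betw_up] finite_addable row_fun_row by blast

lemma finite_down: "is_partition lam \<Longrightarrow> finite (down lam)"
  using bij_betw_finite[OF bij_betw_down] finite_removable row_fun_row by blast

text \<open>This is the relation \<open>D U = U D + 1\<close> of a differential poset, tested on an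
  arbitrary function \<open>g\<close>.\<close>

lemma sum_up_down:
  fixes g :: "nat list \<Rightarrow> real"
  assumes lam: "is_partition lam"
  shows "(\<Sum>mu\<in>up lam. \<Sum>nu\<in>down mu. g nu) = (\<Sum>mu\<in>down lam. \<Sum>nu\<in>up mu. g nu) + g lam"
  using sum_inc_dec[OF row_fun_row[OF lam], of "\<lambda>r. g (unrow r)"]
  by (simp add: sum_up sum_down lam addable_def removable_def is_partition_unrow row_unrow unrow_row
      cong: sum.cong_simp)

section \<open>Sizes of covers\<close>

lemma card_young_diagram: "card (young_diagram lam) = psize lam"
proof -
  have "young_diagram lam = Sigma {..<length lam} (\<lambda>i. {..<lam ! i})"
    by (auto simp: young_diagram_def)
  then show ?thesis by (simp add: sum_list_sum_nth atLeast0LessThan)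
qed

lemma psize_adds_box:
  assumes "adds_box lam mu"
  shows "psize mu = Suc (psize lam)"
proof -
  have "finite (young_diagram lam)"
    by (rule finite_subset[of _ "Sigma {..<length lam} (\<lambda>i. {..<lam ! i})"]) (auto simp: young_diagram_def)
  with assms show ?thesis
    unfolding adds_box_def by (metis card_young_diagram card_insert_disjoint)
qed

lemma up_D: "mu \<in> up lam \<Longrightarrow> is_partition mu \<and> psize mu = Suc (psize lam)"
  by (auto simp: up_def psize_adds_box)

lemma down_D: "mu \<in> down lam \<Longrightarrow> is_partition mu \<and> psize lam = Suc (psize mu)"
  by (auto simp: down_def psize_adds_box)

lemma psize_eq_0: "is_partition lam \<Longrightarrow> psize lam = 0 \<longleftrightarrow> lam = []"
  by (cases lam) (auto simp: is_partition_def)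

lemma down_nonempty:
  assumes "is_partition lam" "lam \<noteq> []"
  shows "down lam \<noteq> {}"
proof -
  \<comment> \<open>The last row is a corner, since the row below it is empty.\<close>
  have "length lam - 1 \<in> removable (row lam)"
    using assms by (auto simp: removable_eq row_fun_row) (auto simp: row_def is_partition_def)
  then show ?thesis using bij_betw_down[OF assms(1)] by (auto simp: bij_betw_def)
qed

section \<open>Standard Young tableaux\<close>

text \<open>Counts the chains of \<open>k\<close> successive box removals that start at
  \<open>lam\<close>. With \<open>k = psize lam\<close> such a chain ends at the empty partition and
  is a standard Young tableau read backwards.\<close>

primrec syt_aux :: "nat \<Rightarrow> nat list \<Rightarrow> real" where
  "syt_aux 0 lam = 1"
| "syt_aux (Suc k) lam = (\<Sum>mu\<in>down lam. syt_aux k mu)"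

definition syt :: "nat list \<Rightarrow> real" where
  "syt lam = syt_aux (psize lam) lam"

lemma syt_Nil: "syt [] = 1"
  by (simp add: syt_def)

lemma sum_down_syt:
  assumes "is_partition lam" "lam \<noteq> []"
  shows "(\<Sum>mu\<in>down lam. syt mu) = syt lam"
proof -
  obtain k where k: "psize lam = Suc k"
    using assms psize_eq_0 not0_implies_Suc by blast
  then have "syt mu = syt_aux k mu" if "mu \<in> down lam" for mu
    using down_D[OF that] by (simp add: syt_def)
  then show ?thesis using k by (simp add: syt_def)
qed

lemma syt_pos: "is_partition lam \<Longrightarrow> 0 < syt lam"
proof (induction "psize lam" arbitrary: lam)
  case 0
  then show ?case using psize_eq_0[of lam] by (simp add: syt_Nil)
next
  case (Suc k)
  then have "lam \<noteq> []" by auto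
  have "0 < (\<Sum>mu\<in>down lam. syt mu)"
    using Suc down_D by (intro sum_pos finite_down down_nonempty \<open>lam \<noteq> []\<close>) fastforce+
  then show ?case using sum_down_syt[OF Suc.prems \<open>lam \<noteq> []\<close>] by simp
qed

text \<open>Expanding each \<open>syt mu\<close> over the shapes below \<open>mu\<close> and
  exchanging the two steps by \<open>sum_up_down\<close> reduces the claim to the smaller shapes in
  \<open>down lam\<close>.\<close>

lemma sum_up_syt: "is_partition lam \<Longrightarrow> (\<Sum>mu\<in>up lam. syt mu) = (real (psize lam) + 1) * syt lam"
proof (induction "psize lam" arbitrary: lam rule: less_induct)
  case less
  have "syt mu = (\<Sum>nu\<in>down mu. syt nu)" if "mu \<in> up lam" for mu
    using up_D[OF that] by (intro sum_down_syt[symmetric]) auto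
  then have "(\<Sum>mu\<in>up lam. syt mu) = (\<Sum>mu\<in>up lam. \<Sum>nu\<in>down mu. syt nu)" by simp
  also have "\<dots> = (\<Sum>mu\<in>down lam. \<Sum>nu\<in>up mu. syt nu) + syt lam"
    by (rule sum_up_down) fact
  also have "(\<Sum>mu\<in>down lam. \<Sum>nu\<in>up mu. syt nu) = (\<Sum>mu\<in>down lam. real (psize lam) * syt mu)"
    using less.hyps down_D by (intro sum.cong) fastforce+
  also have "\<dots> = real (psize lam) * (\<Sum>mu\<in>down lam. syt mu)" by (simp add: sum_distrib_left)
  \<comment> \<open>The recursion for \<open>syt\<close> fails at \<open>[]\<close>, but there the
    factor \<open>psize lam\<close> is zero.\<close>
  also have "\<dots> = real (psize lam) * syt lam"
    using sum_down_syt[OF less.prems] by (cases "lam = []") auto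
  finally show ?case by (simp add: algebra_simps)
qed

section \<open>Oscillating tableaux\<close>

lemma oscillating_tableaux_0:
  "oscillating_tableaux lam 0 = (if lam = [] then {[[]]} else {})"
  by (auto simp: oscillating_tableaux_def is_partition_def length_Suc_conv)

lemma oscillating_tableaux_Suc:
  assumes "is_partition lam"
  shows "oscillating_tableaux lam (Suc l) =
    (\<lambda>T. T @ [lam]) ` (\<Union>mu\<in>up lam \<union> down lam. oscillating_tableaux mu l)"
proof (intro equalityI subsetI)
  fix T assume "T \<in> oscillating_tableaux lam (Suc l)"
  then have T: "length T = Suc (Suc l)" "\<forall>mu\<in>set T. is_partition mu" "T ! 0 = []" "T ! Suc l = lam"
    and st: "\<And>i. i < Suc l \<Longrightarrow> adds_box (T ! i) (T ! Suc i) \<or> adds_box (T ! Suc i) (T ! i)"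
    by (auto simp: oscillating_tableaux_def)
  define T' where "T' = butlast T"
  have TT': "T = T' @ [lam]"
    using T(1,4) unfolding T'_def
    by (metis append_butlast_last_id diff_Suc_1 last_conv_nth list.size(3) nat.distinct(1))
  have len: "length T' = Suc l" using T(1) TT' by simp
  have nth: "T ! i = T' ! i" if "i \<le> l" for i using that len by (simp add: TT' nth_append)
  have "T' \<in> oscillating_tableaux (T ! l) l"
  proof -
    have "\<forall>i<l. adds_box (T' ! i) (T' ! (i + 1)) \<or> adds_box (T' ! (i + 1)) (T' ! i)"
      using st by (simp add: nth[symmetric])
    moreover have "\<forall>mu\<in>set T'. is_partition mu" using T(2) TT' by simp
    ultimately show ?thesis
      using T(3) nth[of 0] nth[of l] len by (simp add: oscillating_tableaux_def)
  qed
  moreover have "T ! l \<in> up lam \<union> down lam"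
    using st[of l] T by (auto simp: up_def down_def)
  ultimately show "T \<in> (\<lambda>T. T @ [lam]) ` (\<Union>mu\<in>up lam \<union> down lam. oscillating_tableaux mu l)"
    using TT' by blast
next
  fix T assume "T \<in> (\<lambda>T. T @ [lam]) ` (\<Union>mu\<in>up lam \<union> down lam. oscillating_tableaux mu l)"
  then obtain T' mu where "T = T' @ [lam]" "mu \<in> up lam \<union> down lam" "T' \<in> oscillating_tableaux mu l"
    by blast
  then show "T \<in> oscillating_tableaux lam (Suc l)"
    using assms
    by (auto simp: oscillating_tableaux_def up_def down_def nth_append less_Suc_eq)
qed

lemma finite_oscillating_tableaux: "is_partition lam \<Longrightarrow> finite (oscillating_tableaux lam l)"
proof (induction l arbitrary: lam)
  case (Suc l)
  then show ?case
    using up_D down_D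
    by (auto simp: oscillating_tableaux_Suc finite_up finite_down intro!: finite_imageI)
qed (simp add: oscillating_tableaux_0)

lemma sum_oscillating_tableaux_Suc:
  fixes h :: "nat list list \<Rightarrow> real"
  assumes lam: "is_partition lam"
  shows "(\<Sum>T\<in>oscillating_tableaux lam (Suc l). h T) =
    (\<Sum>mu\<in>up lam. \<Sum>T\<in>oscillating_tableaux mu l. h (T @ [lam])) +
    (\<Sum>mu\<in>down lam. \<Sum>T\<in>oscillating_tableaux mu l. h (T @ [lam]))"
proof -
  have "(\<Sum>T\<in>oscillating_tableaux lam (Suc l). h T) =
    (\<Sum>T\<in>(\<Union>mu\<in>up lam \<union> down lam. oscillating_tableaux mu l). h (T @ [lam]))"
    by (simp add: oscillating_tableaux_Suc[OF lam] sum.reindex inj_on_def)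
  \<comment> \<open>Tableaux of different shapes \<open>mu\<close> differ in their last entry, so
    the union is disjoint. In the next step \<open>up lam\<close> and \<open>down lam\<close> are
    disjoint because of the sizes.\<close>
  also have "\<dots> = (\<Sum>mu\<in>up lam \<union> down lam. \<Sum>T\<in>oscillating_tableaux mu l. h (T @ [lam]))"
  proof (rule sum.UNION_disjoint)
    show "\<forall>mu\<in>up lam \<union> down lam. finite (oscillating_tableaux mu l)"
      using finite_oscillating_tableaux up_D down_D by blast
  qed (auto simp: finite_up finite_down lam oscillating_tableaux_def)
  also have "\<dots> = (\<Sum>mu\<in>up lam. \<Sum>T\<in>oscillating_tableaux mu l. h (T @ [lam])) +
    (\<Sum>mu\<in>down lam. \<Sum>T\<in>oscillating_tableaux mu l. h (T @ [lam]))"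
    by (rule sum.union_disjoint) (use up_D down_D in \<open>fastforce simp: finite_up finite_down lam\<close>)+
  finally show ?thesis .
qed

text \<open>With \<open>l = k + 2 n\<close> this is the binomial coefficient of \<open>l\<close>
  over \<open>k\<close> times the number of perfect matchings of \<open>2 n\<close> points. The
  value 0 elsewhere lets the recursions hold for all \<open>k\<close> and \<open>l\<close>.\<close>

definition osc_coeff :: "nat \<Rightarrow> nat \<Rightarrow> real" where
  "osc_coeff k l = (if k \<le> l \<and> even (l - k)
     then fact l / (fact k * 2 ^ ((l - k) div 2) * fact ((l - k) div 2)) else 0)"

text \<open>Together with \<open>osc_coeff_down\<close> this says that, among the tableaux of length
  \<open>l + 1\<close> and a shape of size \<open>k\<close>, the fraction
  \<open>(l + 1 - k) / (l + 1)\<close> ends with a removal and \<open>k / (l + 1)\<close> with an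
  addition. These fractions are the weights in the recurrence for averages.\<close>

lemma osc_coeff_up:
  "(real k + 1) * (real l + 1) * osc_coeff (Suc k) l = (real l + 1 - real k) * osc_coeff k (Suc l)"
proof (cases "k \<le> Suc l \<and> even (Suc l - k)")
  case True
  then obtain n where n: "Suc l = k + 2 * n"
    by (metis dvdE le_add_diff_inverse)
  show ?thesis
  \<comment> \<open>If \<open>n = 0\<close> then \<open>Suc l = k\<close>, and the coefficient on
    the left and the factor on the right both vanish.\<close>
  proof (cases n)
    case (Suc m)
    then have l: "l = Suc k + 2 * m" using n by simp
    then have "Suc l - k = 2 * Suc m" "l - Suc k = 2 * m" by simp_all
    moreover define D E :: real where "D = fact k * 2 ^ m * fact m" and "E = 2 * (real m + 1)"
    ultimately have coeffs: "osc_coeff (Suc k) l = fact l / ((real k + 1) * D)"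
      "osc_coeff k (Suc l) = (real l + 1) * fact l / (E * D)"
      using l by (simp_all add: osc_coeff_def algebra_simps)
    have "real l + 1 - real k = E" using l by (simp add: E_def)
    moreover have "real k + 1 \<noteq> 0" "E \<noteq> 0" by (auto simp: E_def)
    ultimately show ?thesis unfolding coeffs by simp
  qed (use n in \<open>simp add: osc_coeff_def\<close>)
qed (auto simp: osc_coeff_def)

lemma osc_coeff_down:
  "(real l + 1) * osc_coeff k l = (real k + 1) * osc_coeff (Suc k) (Suc l)"
proof -
  have "fact (Suc k) = (real k + 1) * fact k" "fact (Suc l) = (real l + 1) * fact l"
    "real k + 1 \<noteq> 0"
    by simp_all
  then show ?thesis by (auto simp: osc_coeff_def mult.assoc simp del: fact_Suc)
qed

lemma osc_coeff_0_0: "osc_coeff 0 0 = 1"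
  by (simp add: osc_coeff_def)

lemma osc_coeff_k_0: "0 < k \<Longrightarrow> osc_coeff k 0 = 0"
  by (simp add: osc_coeff_def)

lemma osc_coeff_pos: "0 < osc_coeff k (k + 2 * n)"
  by (simp add: osc_coeff_def)

text \<open>Both the number of tableaux and the sum of their weights satisfy a recursion of this kind.\<close>

lemma syt_recursion:
  fixes F :: "nat list \<Rightarrow> nat \<Rightarrow> real" and p q :: "nat \<Rightarrow> nat \<Rightarrow> real"
  assumes F0: "\<And>lam. is_partition lam \<Longrightarrow> F lam 0 = (if lam = [] then q 0 0 else 0)"
    and F: "\<And>lam l. is_partition lam \<Longrightarrow> F lam (Suc l) = p (psize lam) (Suc l) * syt lam * osc_coeff (psize lam) (Suc l)
        + (\<Sum>mu\<in>up lam. F mu l) + (\<Sum>mu\<in>down lam. F mu l)"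
    and q: "\<And>k l. (real l + 1) * q k (Suc l) = (real l + 1) * p k (Suc l) +
        (real l + 1 - real k) * q (Suc k) l + real k * q (k - 1) l"
    and lam: "is_partition lam"
  shows "F lam l = syt lam * osc_coeff (psize lam) l * q (psize lam) l"
  using lam
proof (induction l arbitrary: lam)
  case 0
  then show ?case
    using psize_eq_0[OF 0] osc_coeff_k_0[of "psize lam"]
    by (cases "lam = []") (simp_all add: F0 syt_Nil osc_coeff_0_0 del: sum_list_eq_0_iff)
next
  case (Suc l)
  define k where "k = psize lam"
  have U: "(\<Sum>mu\<in>up lam. F mu l) = (real k + 1) * syt lam * osc_coeff (Suc k) l * q (Suc k) l"
  proof -
    have "(\<Sum>mu\<in>up lam. F mu l) = (\<Sum>mu\<in>up lam. syt mu * (osc_coeff (Suc k) l * q (Suc k) l))"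
      using Suc.IH up_D by (intro sum.cong) (fastforce simp: k_def)+
    then show ?thesis
      by (simp add: sum_distrib_right[symmetric] sum_up_syt[OF Suc.prems] k_def)
  qed
  \<comment> \<open>For \<open>lam = []\<close> the truncated \<open>k - 1\<close> does no harm,
    because of the factor \<open>real k = 0\<close>. The factor \<open>real l + 1\<close> is kept on
    the left so that \<open>osc_coeff_down\<close> applies without division.\<close>
  have D: "(real l + 1) * (\<Sum>mu\<in>down lam. F mu l) = real k * syt lam * osc_coeff k (Suc l) * q (k - 1) l"
  proof (cases "lam = []")
    case True
    then have "down lam = {}" using down_D by fastforce
    then show ?thesis using True by (simp add: k_def)
  next
    case False
    then obtain j where j: "k = Suc j"
      using psize_eq_0[OF Suc.prems] by (metis k_def not0_implies_Suc)
    have "(\<Sum>mu\<in>down lam. F mu l) = (\<Sum>mu\<in>down lam. syt mu * (osc_coeff j l * q j l))"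
      using Suc.IH down_D j by (intro sum.cong) (fastforce simp: k_def)+
    also have "\<dots> = syt lam * (osc_coeff j l * q j l)"
      by (simp add: sum_distrib_right[symmetric] sum_down_syt[OF Suc.prems False])
    finally have "(real l + 1) * (\<Sum>mu\<in>down lam. F mu l) = syt lam * q j l * ((real l + 1) * osc_coeff j l)"
      by simp
    then show ?thesis using j by (simp add: osc_coeff_down)
  qed
  have "(real l + 1) * F lam (Suc l) = (real l + 1) * p k (Suc l) * syt lam * osc_coeff k (Suc l)
     + ((real k + 1) * (real l + 1) * osc_coeff (Suc k) l) * syt lam * q (Suc k) l
     + real k * syt lam * osc_coeff k (Suc l) * q (k - 1) l"
    unfolding F[OF Suc.prems] distrib_left D U by (simp add: k_def algebra_simps)
  also have "\<dots> = syt lam * osc_coeff k (Suc l) * ((real l + 1) * q k (Suc l))"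
    unfolding osc_coeff_up q by (simp add: algebra_simps)
  finally have "(real l + 1) * F lam (Suc l) = (real l + 1) * (syt lam * osc_coeff k (Suc l) * q k (Suc l))"
    by simp
  then show ?case by (simp add: k_def)
qed

text \<open>The case \<open>q = 1\<close>, \<open>p = 0\<close> of \<open>syt_recursion\<close>,
  whose condition becomes \<open>l + 1 = (l + 1 - k) + k\<close>.\<close>

lemma card_oscillating_tableaux:
  assumes "is_partition lam"
  shows "real (card (oscillating_tableaux lam l)) = syt lam * osc_coeff (psize lam) l"
proof -
  have S: "real (card (oscillating_tableaux mu (Suc l))) =
      (\<Sum>nu\<in>up mu. real (card (oscillating_tableaux nu l))) +
      (\<Sum>nu\<in>down mu. real (card (oscillating_tableaux nu l)))" if "is_partition mu" for mu l
    using sum_oscillating_tableaux_Suc[OF that, of "\<lambda>_. 1" l] by simp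
  show ?thesis
    using syt_recursion[of "\<lambda>mu l. real (card (oscillating_tableaux mu l))" "\<lambda>_ _. 1" "\<lambda>_ _. 0", OF _ _ _ assms, of l]
    by (simp add: oscillating_tableaux_0 S)
qed

lemma wt_snoc: "wt P (T @ [lam]) = wt P T + eval2 P (real (psize lam)) (real (length T))"
  by (simp add: wt_def nth_append)

text \<open>The last entry of a tableau adds the same value of \<open>P\<close> for all tableaux
  counted, which is the term \<open>p\<close> of \<open>syt_recursion\<close>. With
  \<open>q = (l + 1) Q\<close>, its condition is \<open>l + 1\<close> times the assumption at
  \<open>x = k\<close>, \<open>y = l + 1\<close>.\<close>

lemma sum_wt_oscillating_tableaux:
  assumes Q: "\<And>x y. (y + 1) * eval2 Q x y - (y - x) * eval2 Q (x + 1) (y - 1)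
      - x * eval2 Q (x - 1) (y - 1) = eval2 P x y"
    and lam: "is_partition lam"
  shows "(\<Sum>T\<in>oscillating_tableaux lam l. wt P T) =
    syt lam * osc_coeff (psize lam) l * ((real l + 1) * eval2 Q (real (psize lam)) (real l))"
proof (rule syt_recursion[where p = "\<lambda>k l. eval2 P (real k) (real l)" and
      q = "\<lambda>k l. (real l + 1) * eval2 Q (real k) (real l)", OF _ _ _ lam])
  show "(\<Sum>T\<in>oscillating_tableaux mu 0. wt P T) =
      (if mu = [] then (real 0 + 1) * eval2 Q (real 0) (real 0) else 0)" for mu
    using Q[of 0 0] by (simp add: oscillating_tableaux_0 wt_def)
next
  fix mu l assume mu: "is_partition mu"
  have len: "length T = Suc l" if "T \<in> oscillating_tableaux nu l" for T nu
    using that by (simp add: oscillating_tableaux_def)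
  have "(\<Sum>T\<in>oscillating_tableaux mu (Suc l). wt P T) =
      (\<Sum>nu\<in>up mu. \<Sum>T\<in>oscillating_tableaux nu l. wt P T) + (\<Sum>nu\<in>down mu. \<Sum>T\<in>oscillating_tableaux nu l. wt P T)
      + real (card (oscillating_tableaux mu (Suc l))) * eval2 P (real (psize mu)) (real (Suc l))"
    using sum_oscillating_tableaux_Suc[OF mu, of "\<lambda>_. 1" l]
    by (simp add: sum_oscillating_tableaux_Suc[OF mu] wt_snoc len sum.distrib sum_distrib_right[symmetric]
        algebra_simps del: of_nat_Suc cong: sum.cong_simp)
  then show "(\<Sum>T\<in>oscillating_tableaux mu (Suc l). wt P T) =
      eval2 P (real (psize mu)) (real (Suc l)) * syt mu * osc_coeff (psize mu) (Suc l)
      + (\<Sum>nu\<in>up mu. \<Sum>T\<in>oscillating_tableaux nu l. wt P T) + (\<Sum>nu\<in>down mu. \<Sum>T\<in>oscillating_tableaux nu l. wt P T)"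
    by (simp add: card_oscillating_tableaux[OF mu])
next
  fix k l
  \<comment> \<open>Truncated and real subtraction differ only at \<open>k = 0\<close>, where the
    factor \<open>real k\<close> vanishes.\<close>
  have K: "real k * eval2 Q (real (k - 1)) (real l) = real k * eval2 Q (real k - 1) (real l)"
    by (cases k) auto
  have E: "eval2 P (real k) (real (Suc l)) = (real l + 2) * eval2 Q (real k) (real (Suc l))
      - (real l + 1 - real k) * eval2 Q (real (Suc k)) (real l) - real k * eval2 Q (real (k - 1)) (real l)"
    unfolding K using Q[of "real (Suc l)" "real k"] by (simp add: algebra_simps)
  show "(real l + 1) * ((real (Suc l) + 1) * eval2 Q (real k) (real (Suc l))) =
     (real l + 1) * eval2 P (real k) (real (Suc l)) +
     (real l + 1 - real k) * ((real l + 1) * eval2 Q (real (Suc k)) (real l)) +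
     real k * ((real l + 1) * eval2 Q (real (k - 1)) (real l))"
    unfolding E by (simp add: algebra_simps)
qed

section \<open>Inverting the recurrence operator\<close>

definition ffact :: "nat \<Rightarrow> real \<Rightarrow> real" where
  "ffact a x = (\<Prod>i<a. x - real i)"

lemma ffact_0: "ffact 0 x = 1"
  by (simp add: ffact_def)

lemma ffact_Suc: "ffact (Suc a) x = ffact a x * (x - real a)"
  by (simp add: ffact_def)

lemma ffact_Suc_shift: "x * ffact a (x - 1) = ffact (Suc a) x"
  unfolding ffact_def prod.lessThan_Suc_shift by (simp add: algebra_simps)

lemma ffact_plus_1: "ffact a (x + 1) = ffact a x + real a * ffact (a - 1) x"
proof (cases a)
  case (Suc b)
  then show ?thesis
    using ffact_Suc_shift[of "x + 1" b] by (simp add: ffact_Suc algebra_simps)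
qed (simp add: ffact_0)

text \<open>The operator after the substitution \<open>y = x + 2 * n\<close>: the shift to
  \<open>(x + 1, y - 1)\<close> lowers \<open>n\<close> by 1, while the shift to
  \<open>(x - 1, y - 1)\<close> leaves \<open>n\<close> fixed.\<close>

definition rec_op :: "(real \<Rightarrow> real \<Rightarrow> real) \<Rightarrow> real \<Rightarrow> real \<Rightarrow> real" where
  "rec_op f x n = (x + 2 * n + 1) * f x n - 2 * n * f (x + 1) (n - 1) - x * f (x - 1) n"

lemma rec_op_0: "rec_op (\<lambda>x n. 0) = (\<lambda>x n. 0)"
  by (simp add: rec_op_def fun_eq_iff)

lemma rec_op_linear:
  "rec_op (\<lambda>x n. c * f x n + g x n) = (\<lambda>x n. c * rec_op f x n + rec_op g x n)"
  by (simp add: rec_op_def fun_eq_iff algebra_simps)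

text \<open>The factors \<open>n\<close> and \<open>x\<close> absorb the downward shifts and produce
  \<open>n - b\<close> and \<open>x - a\<close>, so that \<open>x + 2 * n\<close> cancels. The
  upward shift in \<open>x\<close> contributes the off-diagonal term as a forward
  difference.\<close>

lemma rec_op_ffact:
  "rec_op (\<lambda>x n. ffact a x * ffact b n) x n =
     (1 + real a + 2 * real b) * (ffact a x * ffact b n) - 2 * real a * (ffact (a - 1) x * ffact (Suc b) n)"
proof -
  have "rec_op (\<lambda>x n. ffact a x * ffact b n) x n = (x + 2 * n + 1) * (ffact a x * ffact b n)
      - 2 * ffact a (x + 1) * (n * ffact b (n - 1)) - (x * ffact a (x - 1)) * ffact b n"
    by (simp add: rec_op_def algebra_simps)
  also have "\<dots> = (x + 2 * n + 1) * (ffact a x * ffact b n)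
      - 2 * (ffact a x + real a * ffact (a - 1) x) * (ffact b n * (n - real b))
      - ffact a x * (x - real a) * ffact b n"
    by (simp add: ffact_Suc_shift ffact_plus_1 ffact_Suc)
  also have "\<dots> = (1 + real a + 2 * real b) * (ffact a x * ffact b n)
      - 2 * real a * (ffact (a - 1) x * ffact (Suc b) n)"
    by (simp add: ffact_Suc algebra_simps)
  finally show ?thesis .
qed

text \<open>The linear span of the basis products of total order at most \<open>d\<close>, built one
  term at a time so that linear statements follow by rule induction.\<close>

inductive ffspan :: "nat \<Rightarrow> (real \<Rightarrow> real \<Rightarrow> real) \<Rightarrow> bool" for d where
  zero: "ffspan d (\<lambda>x n. 0)"
| step: "a + b \<le> d \<Longrightarrow> ffspan d f \<Longrightarrow> ffspan d (\<lambda>x n. c * (ffact a x * ffact b n) + f x n)"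

lemma ffspan_basis: "a + b \<le> d \<Longrightarrow> ffspan d (\<lambda>x n. ffact a x * ffact b n)"
  using ffspan.step[OF _ ffspan.zero, of a b d 1] by simp

lemma ffspan_lincomb: "ffspan d f \<Longrightarrow> ffspan d g \<Longrightarrow> ffspan d (\<lambda>x n. c * f x n + g x n)"
proof (induction rule: ffspan.induct)
  case (step a b f c')
  then show ?case
    using ffspan.step[of a b d "\<lambda>x n. c * f x n + g x n" "c * c'"] by (simp add: algebra_simps)
qed simp

lemma ffspan_scale: "ffspan d f \<Longrightarrow> ffspan d (\<lambda>x n. c * f x n)"
  using ffspan_lincomb[OF _ ffspan.zero] by simp

lemma ffspan_add: "ffspan d f \<Longrightarrow> ffspan d g \<Longrightarrow> ffspan d (\<lambda>x n. f x n + g x n)"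
  using ffspan_lincomb[of d f g 1] by simp

lemma ffspan_sum: "(\<And>i. i \<in> A \<Longrightarrow> ffspan d (f i)) \<Longrightarrow> ffspan d (\<lambda>x n. \<Sum>i\<in>A. f i x n)"
  by (induction A rule: infinite_finite_induct) (auto intro: ffspan.zero ffspan_add)

lemma ffspan_mono: "ffspan d f \<Longrightarrow> d \<le> e \<Longrightarrow> ffspan e f"
  by (induction rule: ffspan.induct) (auto intro: ffspan.intros)

lemma ffspan_times_x: "ffspan d f \<Longrightarrow> ffspan (Suc d) (\<lambda>x n. x * f x n)"
proof (induction rule: ffspan.induct)
  case (step a b f c)
  have "ffspan (Suc d) (\<lambda>x n. c * (ffact (Suc a) x * ffact b n) + (c * real a * (ffact a x * ffact b n) + x * f x n))"
    using step by (intro ffspan.step) auto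
  then show ?case by (simp add: ffact_Suc algebra_simps)
qed (simp add: ffspan.zero)

lemma ffspan_times_n: "ffspan d f \<Longrightarrow> ffspan (Suc d) (\<lambda>x n. n * f x n)"
proof (induction rule: ffspan.induct)
  case (step a b f c)
  have "ffspan (Suc d) (\<lambda>x n. c * (ffact a x * ffact (Suc b) n) + (c * real b * (ffact a x * ffact b n) + n * f x n))"
    using step by (intro ffspan.step) auto
  then show ?case by (simp add: ffact_Suc algebra_simps)
qed (simp add: ffspan.zero)

lemma ffspan_times_y: "ffspan d f \<Longrightarrow> ffspan (Suc d) (\<lambda>x n. (x + 2 * n) * f x n)"
  using ffspan_lincomb[OF ffspan_times_n ffspan_times_x, of d f f 2] by (simp add: algebra_simps)

lemma ffspan_monomial: "ffspan (i + j) (\<lambda>x n. x ^ i * (x + 2 * n) ^ j)"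
proof (induction i)
  case 0
  show ?case
  proof (induction j)
    case 0
    show ?case using ffspan_basis[of 0 0] by (simp add: ffact_0)
  next
    case (Suc j)
    then show ?case using ffspan_times_y[OF Suc.IH] by (simp add: algebra_simps)
  qed
next
  case (Suc i)
  then show ?case using ffspan_times_x[OF Suc.IH] by (simp add: algebra_simps)
qed

text \<open>The off-diagonal term has the same total order as the diagonal one, and for
  \<open>a = 0\<close> its coefficient vanishes.\<close>

lemma ffspan_rec_op: "ffspan d f \<Longrightarrow> ffspan d (rec_op f)"
proof (induction rule: ffspan.induct)
  case zero
  show ?case by (simp add: rec_op_0 ffspan.zero)
next
  case (step a b f c)
  have "ffspan d (\<lambda>x n. 2 * real a * (ffact (a - 1) x * ffact (Suc b) n))"
  proof (cases a)
    case 0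
    then show ?thesis by (simp add: ffspan.zero)
  next
    case (Suc k)
    then show ?thesis using step(1) by (intro ffspan_scale ffspan_basis) simp
  qed
  then have "ffspan d (rec_op (\<lambda>x n. ffact a x * ffact b n))"
    using ffspan_lincomb[of d "\<lambda>x n. 2 * real a * (ffact (a - 1) x * ffact (Suc b) n)"
        "\<lambda>x n. (1 + real a + 2 * real b) * (ffact a x * ffact b n)" "-1"]
      ffspan_scale[OF ffspan_basis[OF step(1)]]
    by (simp add: rec_op_ffact[abs_def])
  then show ?case
    unfolding rec_op_linear by (intro ffspan_lincomb step)
qed

text \<open>Back substitution in a triangular system: the off-diagonal term has smaller
  \<open>a\<close>, and the diagonal entry is positive.\<close>

lemma rec_op_basis_surj:
  "a + b \<le> d \<Longrightarrow> \<exists>g. ffspan d g \<and> rec_op g = (\<lambda>x n. ffact a x * ffact b n)"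
proof (induction a arbitrary: b)
  case 0
  \<comment> \<open>The summand 0 brings the witness into the form of \<open>rec_op_linear\<close>
    and \<open>ffspan.step\<close>.\<close>
  let ?g = "\<lambda>x n. inverse (1 + 2 * real b) * (ffact 0 x * ffact b n) + 0"
  have "rec_op ?g = (\<lambda>x n. ffact 0 x * ffact b n)"
    unfolding rec_op_linear rec_op_0 by (auto simp: rec_op_ffact field_simps fun_eq_iff)
  moreover have "ffspan d ?g" using 0 by (intro ffspan.intros) simp
  ultimately show ?case by blast
next
  case (Suc a)
  then obtain g where g: "ffspan d g" "rec_op g = (\<lambda>x n. ffact a x * ffact (Suc b) n)"
    by (metis add_Suc_shift)
  define s where "s = 1 + real (Suc a) + 2 * real b"
  have s: "s > 0" by (simp add: s_def)
  \<comment> \<open>Dividing by the diagonal entry \<open>s\<close> normalises the leading term; the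
    multiple of \<open>g\<close> cancels the off-diagonal term that remains.\<close>
  let ?h = "\<lambda>x n. 2 * real (Suc a) / s * g x n + inverse s * (ffact (Suc a) x * ffact b n)"
  have "?h = (\<lambda>x n. inverse s * (ffact (Suc a) x * ffact b n) + (2 * real (Suc a) / s * g x n))"
    by (simp add: fun_eq_iff)
  then have "rec_op ?h = (\<lambda>x n. inverse s * rec_op (\<lambda>x n. ffact (Suc a) x * ffact b n) x n + rec_op (\<lambda>x n. 2 * real (Suc a) / s * g x n + 0) x n)"
    by (simp only: rec_op_linear add_0_right)
  also have "\<dots> = (\<lambda>x n. ffact (Suc a) x * ffact b n)"
    unfolding rec_op_linear rec_op_0 rec_op_ffact g(2) s_def[symmetric] using s
    by (simp add: field_simps fun_eq_iff)
  finally have "rec_op ?h = (\<lambda>x n. ffact (Suc a) x * ffact b n)" .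
  moreover have "ffspan d ?h"
    using g(1) Suc.prems by (intro ffspan_lincomb ffspan_scale ffspan_basis)
  ultimately show ?case by blast
qed

lemma rec_op_surj: "ffspan d f \<Longrightarrow> \<exists>g. ffspan d g \<and> rec_op g = f"
proof (induction rule: ffspan.induct)
  case zero
  show ?case using ffspan.zero rec_op_0 by blast
next
  case (step a b f c)
  then obtain g where g: "ffspan d g" "rec_op g = f" by blast
  obtain h where h: "ffspan d h" "rec_op h = (\<lambda>x n. ffact a x * ffact b n)"
    using rec_op_basis_surj[OF step(1)] by blast
  have "rec_op (\<lambda>x n. c * h x n + g x n) = (\<lambda>x n. c * (ffact a x * ffact b n) + f x n)"
    by (simp add: rec_op_linear g h)
  then show ?case using ffspan_lincomb[OF h(1) g(1)] by blast
qed

section \<open>Bivariate polynomials\<close>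

text \<open>\<open>Max\<close> can be compared termwise only on a finite set, so the exponents of
  nonzero coefficients are first confined to a finite set.\<close>

lemma total_degree_le_iff:
  "total_degree Q \<le> d \<longleftrightarrow> (\<forall>i j. coeff (coeff Q j) i \<noteq> 0 \<longrightarrow> i + j \<le> d)"
proof -
  let ?S = "{i + j | i j. coeff (coeff Q j) i \<noteq> 0}"
  have "?S \<subseteq> (\<lambda>(i, j). i + j) ` (\<Union>j\<in>{..degree Q}. {..degree (coeff Q j)} \<times> {j})"
  proof
    fix m assume "m \<in> ?S"
    then obtain i j where ij: "m = i + j" "coeff (coeff Q j) i \<noteq> 0" by blast
    then have "i \<le> degree (coeff Q j)" "j \<le> degree Q"
      by (auto intro!: le_degree)
    then show "m \<in> (\<lambda>(i, j). i + j) ` (\<Union>j\<in>{..degree Q}. {..degree (coeff Q j)} \<times> {j})"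
      using ij by force
  qed
  then have "finite ?S" by (rule finite_subset) auto
  then show ?thesis unfolding total_degree_def by (auto simp: Max_le_iff)
qed

lemma eval2_0: "eval2 0 x y = 0"
  and eval2_add: "eval2 (P + Q) x y = eval2 P x y + eval2 Q x y"
  and eval2_smult: "eval2 (smult p P) x y = poly p x * eval2 P x y"
  and eval2_pCons: "eval2 (pCons p P) x y = poly p x + y * eval2 P x y"
  by (simp_all add: eval2_def)

lemma eval2_altdef:
  "eval2 P x y = (\<Sum>j\<le>degree P. \<Sum>i\<le>degree (coeff P j). coeff (coeff P j) i * (x ^ i * y ^ j))"
proof -
  have "eval2 P x y = (\<Sum>j\<le>degree P. poly (coeff P j) x * y ^ j)"
    by (simp add: eval2_def poly_altdef[of P] poly_sum poly_const_pow mult.commute)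
  then show ?thesis by (simp add: poly_altdef sum_distrib_right mult.assoc)
qed

text \<open>A nonzero polynomial over the integral domain \<open>real poly\<close> has finitely many
  roots, whereas \<open>P - Q\<close> would vanish at all the constants
  \<open>[:y:]\<close>.\<close>

lemma eval2_inject:
  assumes "\<And>x y. eval2 P x y = eval2 Q x y"
  shows "P = Q"
proof (rule ccontr)
  assume "P \<noteq> Q"
  then have "finite {p. poly (P - Q) p = 0}" by (intro poly_roots_finite) simp
  moreover have "poly (P - Q) [:y:] = 0" for y
    using assms unfolding eval2_def by (simp add: poly_eq_poly_eq_iff[symmetric] fun_eq_iff)
  then have "range (\<lambda>y. [:y:]) \<subseteq> {p. poly (P - Q) p = 0}" by auto
  ultimately have "finite (range (\<lambda>y::real. [:y:]))" by (rule finite_subset[rotated])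
  then show False
    by (subst (asm) finite_image_iff) (auto simp: inj_on_def infinite_UNIV_char_0)
qed

lemma ffspan_eval2:
  assumes "total_degree P \<le> d"
  shows "ffspan d (\<lambda>x n. eval2 P x (x + 2 * n))"
  unfolding eval2_altdef
proof (intro ffspan_sum)
  fix i j
  show "ffspan d (\<lambda>x n. coeff (coeff P j) i * (x ^ i * (x + 2 * n) ^ j))"
  proof (cases "coeff (coeff P j) i = 0")
    case False
    then have "i + j \<le> d" using assms unfolding total_degree_le_iff by blast
    then show ?thesis by (intro ffspan_scale ffspan_mono[OF ffspan_monomial])
  qed (simp add: ffspan.zero)
qed

text \<open>Working with functions allows the change of coordinates back to \<open>y\<close> without
  computing coefficients.\<close>

definition polyfun2 :: "nat \<Rightarrow> (real \<Rightarrow> real \<Rightarrow> real) \<Rightarrow> bool" where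
  "polyfun2 d f \<longleftrightarrow> (\<exists>Q. total_degree Q \<le> d \<and> (\<forall>x y. eval2 Q x y = f x y))"

lemma polyfun2_const: "polyfun2 d (\<lambda>x y. c)"
  unfolding polyfun2_def
  by (rule exI[of _ "[:[:c:]:]"]) (auto simp: total_degree_le_iff coeff_pCons eval2_pCons eval2_0 split: nat.splits)

lemma polyfun2_lincomb: "polyfun2 d f \<Longrightarrow> polyfun2 d g \<Longrightarrow> polyfun2 d (\<lambda>x y. c * f x y + g x y)"
proof -
  assume "polyfun2 d f" "polyfun2 d g"
  then obtain P Q where "total_degree P \<le> d" "\<forall>x y. eval2 P x y = f x y"
    "total_degree Q \<le> d" "\<forall>x y. eval2 Q x y = g x y"
    unfolding polyfun2_def by blast
  then show ?thesis
    unfolding polyfun2_def total_degree_le_iff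
    by (intro exI[of _ "smult [:c:] P + Q"]) (auto simp: eval2_add eval2_smult, metis add_0 mult_zero_right)
qed

lemma polyfun2_mono: "polyfun2 d f \<Longrightarrow> d \<le> e \<Longrightarrow> polyfun2 e f"
  unfolding polyfun2_def by (meson le_trans)

lemma polyfun2_times_x: "polyfun2 d f \<Longrightarrow> polyfun2 (Suc d) (\<lambda>x y. x * f x y)"
proof -
  assume "polyfun2 d f"
  then obtain P where "total_degree P \<le> d" "\<forall>x y. eval2 P x y = f x y"
    unfolding polyfun2_def by blast
  then show ?thesis
    unfolding polyfun2_def total_degree_le_iff
    by (intro exI[of _ "smult [:0, 1:] P"]) (auto simp: eval2_smult coeff_pCons split: nat.splits)
qed

lemma polyfun2_times_y: "polyfun2 d f \<Longrightarrow> polyfun2 (Suc d) (\<lambda>x y. y * f x y)"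
proof -
  assume "polyfun2 d f"
  then obtain P where "total_degree P \<le> d" "\<forall>x y. eval2 P x y = f x y"
    unfolding polyfun2_def by blast
  then show ?thesis
    unfolding polyfun2_def total_degree_le_iff
    by (intro exI[of _ "pCons 0 P"]) (auto simp: eval2_pCons coeff_pCons split: nat.splits)
qed

lemma polyfun2_basis: "polyfun2 (a + b) (\<lambda>x y. ffact a x * ffact b ((y - x) / 2))"
proof (induction a)
  case 0
  show ?case
  proof (induction b)
    case 0
    show ?case by (simp add: ffact_0 polyfun2_const)
  next
    case (Suc b)
    let ?f = "\<lambda>x y. ffact 0 x * ffact b ((y - x) / 2)"
    \<comment> \<open>The new factor \<open>(y - x) / 2 - b\<close> is multiplied out; the final 0
      fits the shape of \<open>polyfun2_lincomb\<close>.\<close>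
    have "polyfun2 (Suc b) (\<lambda>x y. (1/2) * (y * ?f x y) + ((-1/2) * (x * ?f x y) + ((- real b) * ?f x y + 0)))"
      using Suc by (intro polyfun2_lincomb polyfun2_times_x polyfun2_times_y polyfun2_const)
        (auto intro: polyfun2_mono)
    then show ?case by (simp add: ffact_Suc algebra_simps diff_divide_distrib)
  qed
next
  case (Suc a)
  let ?f = "\<lambda>x y. ffact a x * ffact b ((y - x) / 2)"
  have "polyfun2 (Suc (a + b)) (\<lambda>x y. (- real a) * ?f x y + x * ?f x y)"
    using Suc by (intro polyfun2_lincomb polyfun2_times_x) (auto intro: polyfun2_mono)
  then show ?case by (simp add: ffact_Suc algebra_simps)
qed

lemma ffspan_polyfun2: "ffspan d f \<Longrightarrow> polyfun2 d (\<lambda>x y. f x ((y - x) / 2))"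
proof (induction rule: ffspan.induct)
  case (step a b f c)
  then show ?case
    by (intro polyfun2_lincomb[where f = "\<lambda>x y. ffact a x * ffact b ((y - x) / 2)"] polyfun2_mono[OF polyfun2_basis])
qed (rule polyfun2_const)

lemma constant_term_eval2: "constant_term P = eval2 P 0 0"
  by (simp add: constant_term_def eval2_def poly_0_coeff_0[symmetric])

lemma recurrence_solvable:
  "\<exists>Q. total_degree Q = total_degree P \<and>
     (\<forall>x y. (y + 1) * eval2 Q x y - (y - x) * eval2 Q (x + 1) (y - 1)
       - x * eval2 Q (x - 1) (y - 1) = eval2 P x y)"
proof -
  obtain g where g: "ffspan (total_degree P) g" "rec_op g = (\<lambda>x n. eval2 P x (x + 2 * n))"
    using rec_op_surj[OF ffspan_eval2[OF order_refl]] by blast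
  obtain Q where Q: "total_degree Q \<le> total_degree P" "\<And>x y. eval2 Q x y = g x ((y - x) / 2)"
    using ffspan_polyfun2[OF g(1)] unfolding polyfun2_def by blast
  have g_Q: "g = (\<lambda>x n. eval2 Q x (x + 2 * n))" by (simp add: fun_eq_iff Q(2))
  have "(y + 1) * eval2 Q x y - (y - x) * eval2 Q (x + 1) (y - 1)
       - x * eval2 Q (x - 1) (y - 1) = eval2 P x y" for x y
    using fun_cong[OF fun_cong[OF g(2)], of x "(y - x) / 2"]
    by (simp add: rec_op_def Q(2) algebra_simps diff_divide_distrib add_divide_distrib)
  \<comment> \<open>The reverse degree bound: \<open>P\<close> is the image of \<open>Q\<close>, and
    the operator does not raise the degree.\<close>
  moreover have "ffspan (total_degree Q) (\<lambda>x n. eval2 P x (x + 2 * n))"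
    using ffspan_rec_op[OF ffspan_eval2[OF order_refl, of Q]] g(2) g_Q by simp
  then obtain P' where P': "total_degree P' \<le> total_degree Q" "\<And>x y. eval2 P' x y = eval2 P x y"
    using ffspan_polyfun2[of "total_degree Q" "\<lambda>x n. eval2 P x (x + 2 * n)"]
    unfolding polyfun2_def by (auto simp: diff_divide_distrib)
  then have "P' = P" by (intro eval2_inject)
  ultimately show ?thesis using P'(1) Q(1) by (intro exI[of _ Q]) auto
qed

theorem theorem1p3:
  fixes P :: "real poly poly"
  shows "\<exists>Q :: real poly poly.
    total_degree Q = total_degree P \<and> constant_term Q = constant_term P \<and>
    (\<forall>(n :: nat) (lam :: nat list). is_partition lam \<longrightarrow>
       1 / real (card (oscillating_tableaux lam (psize lam + 2 * n))) *
         (\<Sum>T\<in>oscillating_tableaux lam (psize lam + 2 * n). wt P T)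
       = real (psize lam + 2 * n + 1) * eval2 Q (real (psize lam)) (real (psize lam + 2 * n)))"
proof -
  obtain Q where deg: "total_degree Q = total_degree P" and
    rec: "\<And>x y. (y + 1) * eval2 Q x y - (y - x) * eval2 Q (x + 1) (y - 1)
      - x * eval2 Q (x - 1) (y - 1) = eval2 P x y"
    using recurrence_solvable by blast
  \<comment> \<open>At the origin both shifted terms carry the factor 0.\<close>
  have "constant_term Q = constant_term P"
    using rec[of 0 0] by (simp add: constant_term_eval2)
  moreover have "1 / real (card (oscillating_tableaux lam (psize lam + 2 * n))) *
         (\<Sum>T\<in>oscillating_tableaux lam (psize lam + 2 * n). wt P T)
       = real (psize lam + 2 * n + 1) * eval2 Q (real (psize lam)) (real (psize lam + 2 * n))"
    if "is_partition lam" for n lam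
    \<comment> \<open>The number of tableaux is positive, so it cancels from the quotient.\<close>
    unfolding card_oscillating_tableaux[OF that] sum_wt_oscillating_tableaux[OF rec that]
    using syt_pos[OF that] osc_coeff_pos[of "psize lam" n] by (simp add: field_simps)
  ultimately show ?thesis using deg by blast
qed

end
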